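(* Let $0<\alpha<1$, $T>0$, and let $U_0,U_m\in\mathbb{R}$ with $U_0>U_m$. Consider the problem of finding a pair $(u,s)$ such that $$\begin{array}{lll} (i) & \frac{\partial}{\partial t}u(x,t)-\frac{\partial}{\partial x}\,{}^C_0D_x^\alpha u(x,t)=0, & 0<x<s(t),\ 0<t<T,\\ (ii) & u(0,t)=U_0, & 0<t<T,\\ (iii) & u(s(t),t)=U_m, & 0<t<T,\\ (iv) & s(0)=0, & \\ (v) & \dot{s}(t)=-({}^C_0D_x^\alpha u)(s(t),t), & 0<t<T. \end{array}$$ Define $$H_\alpha(x)=\frac{(U_0-U_m)\left(\Gamma(\alpha)(1+\alpha)-\displaystyle\int_0^x w\,\sigma_\alpha(w)\,dw\right)}{\displaystyle\int_0^x\sigma_\alpha(w)\,dw},\qquad x>0.$$ Then the equation $H_\alpha(x)=x$, $x>0$, has a unique solution $\xi_\alpha\in\mathbb{R}^+$, and the pair $$u_\alpha(x,t)=U_0-\frac{U_0-U_m}{\displaystyle\int_0^{\xi_\alpha}\sigma_\alpha(w)\,dw}\int_0^{x/t^{1/(1+\alpha)}}\sigma_\alpha(w)\,dw,\qquad s_\alpha(t)=\xi_\alpha\,t^{\frac{1}{1+\alpha}},$$ is a solution of the problem (i)–(v).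
   Context: For $0<\alpha<1$ the Caputo derivative in the space variable is ${}^C_0D_x^{\alpha}u(x,t)=\frac{1}{\Gamma(1-\alpha)}\int_0^x\frac{u_x(p,t)}{(x-p)^\alpha}\,dp$. In condition (v), $({}^C_0D_x^\alpha u)(s(t),t)$ means $\lim_{x\to s(t)^-}{}^C_0D_x^\alpha u(x,t)$. Equation (i) is understood pointwise: all derivatives and integrals involved exist (the integral defining the Caputo derivative converging absolutely) and the identity holds. The formula for $s_\alpha$ is also used at $t=0$, giving $s_\alpha(0)=0$. The three-parametric Mittag-Leffler function is, for $\alpha>0$, $m>0$ and $l$ with $\alpha(jm+l)\neq-1,-2,-3,\dots$ for $j=0,1,2,\dots$, $$E_{\alpha,m,l}(z)=\sum_{n=0}^\infty c_nz^n,\qquad c_0=1,\quad c_n=\prod_{j=0}^{n-1}\frac{\Gamma(\alpha(jm+l)+1)}{\Gamma(\alpha(jm+l+1)+1)}\ (n\ge1).$$ The function $\sigma_\alpha:\mathbb{R}^+\to\mathbb{R}$ is $\sigma_\alpha(w)=w^{\alpha-1}E_{\alpha,1+\frac1\alpha,1}\left(-\frac{w^{1+\alpha}}{1+\alpha}\right)$. *)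

theory Defs
  imports "HOL-Analysis.Analysis"
begin

definition mittag_leffler_coeff :: "real \<Rightarrow> real \<Rightarrow> real \<Rightarrow> nat \<Rightarrow> real" where
  "mittag_leffler_coeff \<alpha> m l n =
     (\<Prod>j<n. Gamma (\<alpha> * (real j * m + l) + 1) / Gamma (\<alpha> * (real j * m + l + 1) + 1))"

definition mittag_leffler :: "real \<Rightarrow> real \<Rightarrow> real \<Rightarrow> real \<Rightarrow> real" where
  "mittag_leffler \<alpha> m l z = (\<Sum>n. mittag_leffler_coeff \<alpha> m l n * z ^ n)"

definition ml_sigma :: "real \<Rightarrow> real \<Rightarrow> real" where
  "ml_sigma \<alpha> w =
     w powr (\<alpha> - 1) * mittag_leffler \<alpha> (1 + 1 / \<alpha>) 1 (- (w powr (1 + \<alpha>)) / (1 + \<alpha>))"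

definition caputo_deriv :: "real \<Rightarrow> (real \<Rightarrow> real) \<Rightarrow> real \<Rightarrow> real" where
  "caputo_deriv \<alpha> f x =
     1 / Gamma (1 - \<alpha>) * (LBINT p=0..x. deriv f p / (x - p) powr \<alpha>)"

text \<open>
  Since \<^const>\<open>deriv\<close> and the Lebesgue integral are total, \<^const>\<open>caputo_deriv\<close> has a value even
  where the Caputo derivative is undefined; existence (with absolute convergence of the integral)
  is therefore stated separately.
\<close>
definition caputo_exists :: "real \<Rightarrow> (real \<Rightarrow> real) \<Rightarrow> real \<Rightarrow> bool" where
  "caputo_exists \<alpha> f x \<longleftrightarrow>
     (\<forall>p. 0 < p \<and> p < x \<longrightarrow> f differentiable (at p)) \<and>
     interval_lebesgue_integrable lborel 0 x (\<lambda>p. deriv f p / (x - p) powr \<alpha>)"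

text \<open>
  The free boundary problem. The positivity of \<open>s t\<close> says that the domain \<open>0 < x < s t\<close> is
  nonempty, so that the left limit in the Stefan condition (the last clause) only involves points
  at which the preceding clauses ensure that the Caputo derivative exists.
\<close>
definition stefan_solution ::
  "real \<Rightarrow> real \<Rightarrow> real \<Rightarrow> real \<Rightarrow> (real \<Rightarrow> real \<Rightarrow> real) \<Rightarrow> (real \<Rightarrow> real) \<Rightarrow> bool" where
  "stefan_solution \<alpha> T U\<^sub>0 U\<^sub>m u s \<longleftrightarrow>
     (\<forall>t. 0 < t \<and> t < T \<longrightarrow> 0 < s t) \<and>
     (\<forall>x t. 0 < t \<and> t < T \<and> 0 < x \<and> x < s t \<longrightarrow>
        (\<lambda>\<tau>. u x \<tau>) differentiable (at t) \<and>
        caputo_exists \<alpha> (\<lambda>p. u p t) x \<and>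
        (\<lambda>y. caputo_deriv \<alpha> (\<lambda>p. u p t) y) differentiable (at x) \<and>
        deriv (\<lambda>\<tau>. u x \<tau>) t - deriv (\<lambda>y. caputo_deriv \<alpha> (\<lambda>p. u p t) y) x = 0) \<and>
     (\<forall>t. 0 < t \<and> t < T \<longrightarrow> u 0 t = U\<^sub>0) \<and>
     (\<forall>t. 0 < t \<and> t < T \<longrightarrow> u (s t) t = U\<^sub>m) \<and>
     s 0 = 0 \<and>
     (\<forall>t. 0 < t \<and> t < T \<longrightarrow>
        (\<exists>L. ((\<lambda>x. caputo_deriv \<alpha> (\<lambda>p. u p t) x) \<longlongrightarrow> L) (at_left (s t)) \<and>
             (s has_real_derivative - L) (at t)))"

definition H_fun :: "real \<Rightarrow> real \<Rightarrow> real \<Rightarrow> real \<Rightarrow> real" where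
  "H_fun \<alpha> U\<^sub>0 U\<^sub>m x =
     (U\<^sub>0 - U\<^sub>m) * (Gamma \<alpha> * (1 + \<alpha>) - (LBINT w=0..x. w * ml_sigma \<alpha> w)) /
     (LBINT w=0..x. ml_sigma \<alpha> w)"

definition u_sol :: "real \<Rightarrow> real \<Rightarrow> real \<Rightarrow> real \<Rightarrow> real \<Rightarrow> real \<Rightarrow> real" where
  "u_sol \<alpha> U\<^sub>0 U\<^sub>m \<xi> x t =
     U\<^sub>0 - (U\<^sub>0 - U\<^sub>m) / (LBINT w=0..\<xi>. ml_sigma \<alpha> w) *
          (LBINT w=0..ereal (x / t powr (1 / (1 + \<alpha>))). ml_sigma \<alpha> w)"

definition s_sol :: "real \<Rightarrow> real \<Rightarrow> real \<Rightarrow> real" where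
  "s_sol \<alpha> \<xi> t = \<xi> * t powr (1 / (1 + \<alpha>))"

end

theory Submission
  imports Defs "HOL-Real_Asymp.Real_Asymp"
begin

text \<open>
  Write \<open>\<sigma>\<^sub>\<alpha>(w) = w powr (\<alpha> - 1) * E (w powr (1 + \<alpha>))\<close> with \<open>E\<close> entire. Integrating the series
  termwise against \<open>(x - w) powr (- \<alpha>)\<close> by the Beta integral, the recursion of the coefficients says
  that the Riemann-Liouville integral \<open>G\<close> of order \<open>1 - \<alpha>\<close> of \<open>\<sigma>\<^sub>\<alpha>\<close> satisfies
  \<open>G' x = - x * \<sigma>\<^sub>\<alpha>(x) / (1 + \<alpha>)\<close> and \<open>G 0 = \<Gamma>(\<alpha>)\<close>; in similarity variables this is the diffusion equation, and
  \<open>H\<^sub>\<alpha>(\<xi>) = \<xi>\<close> is the Stefan condition. A maximum principle gives \<open>\<sigma>\<^sub>\<alpha> > 0\<close>, whence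
  \<open>(U\<^sub>0 - U\<^sub>m) * (1 + \<alpha>) * G x - x * (\<integral>\<^sub>0\<^sup>x \<sigma>\<^sub>\<alpha>)\<close> decreases strictly from a positive value to \<open>-\<infinity>\<close>.
\<close>

section \<open>Quotients of values of the Gamma function\<close>

text \<open>The point \<open>x\<close> is the convex combination of \<open>x + d\<close> and
  \<open>x + d - 1\<close> with weights \<open>1 - d\<close> and \<open>d\<close>. Log-convexity
  applies there, and the functional equation eliminates \<open>Gamma (x + d - 1)\<close>. The bound
  serves to make ratios of consecutive series coefficients tend to 0.\<close>

lemma Gamma_ratio_le:
  fixes x d :: real
  assumes "0 \<le> d" "d \<le> 1" "0 < x" "1 < x + d"
  shows "Gamma x / Gamma (x + d) \<le> (x + d - 1) powr (- d)"
proof -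
  let ?y = "x + d - 1"
  have Gy: "Gamma (x + d) = ?y * Gamma ?y"
    using Gamma_plus1[of ?y] assms by (force dest!: nonpos_Ints_nonpos)
  have "(ln \<circ> Gamma) ((1 - d) *\<^sub>R (x + d) + d *\<^sub>R ?y)
        \<le> (1 - d) * (ln \<circ> Gamma) (x + d) + d * (ln \<circ> Gamma) ?y"
    using assms by (intro convex_onD[OF log_convex_Gamma_real]) auto
  also have "(1 - d) *\<^sub>R (x + d) + d *\<^sub>R ?y = x" by (simp add: algebra_simps)
  finally have "ln (Gamma x) \<le> (1 - d) * ln (Gamma (x + d)) + d * ln (Gamma ?y)" by simp
  moreover have "ln (Gamma ?y) = ln (Gamma (x + d)) - ln ?y"
  proof -
    have "0 < ?y" using assms by simp
    moreover from this have "0 < Gamma ?y" by (rule Gamma_real_pos)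
    ultimately have "ln (?y * Gamma ?y) = ln ?y + ln (Gamma ?y)" by (rule ln_mult_pos)
    then show ?thesis by (simp add: Gy)
  qed
  ultimately have "ln (Gamma x) \<le> (1 - d) * ln (Gamma (x + d)) + d * (ln (Gamma (x + d)) - ln ?y)"
    by (simp only:)
  then have "ln (Gamma x) \<le> ln (Gamma (x + d)) + (- d) * ln ?y"
    by (simp add: algebra_simps)
  then have "exp (ln (Gamma x)) \<le> exp (ln (Gamma (x + d)) + (- d) * ln ?y)" by simp
  also have "\<dots> = exp (ln (Gamma (x + d))) * ?y powr (- d)"
    using assms unfolding exp_add powr_def by simp
  finally have "exp (ln (Gamma x)) \<le> exp (ln (Gamma (x + d))) * ?y powr (- d)" .
  moreover have "0 < Gamma x" "0 < Gamma (x + d)" using assms by (intro Gamma_real_pos; linarith)+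
  ultimately have "Gamma x \<le> Gamma (x + d) * ?y powr (- d)"
    by (simp only: exp_ln)
  with \<open>0 < Gamma (x + d)\<close> show ?thesis by (simp add: pos_divide_le_eq mult.commute)
qed

section \<open>The similarity profile as a power series\<close>

locale stefan_order =
  fixes \<alpha> :: real
  assumes order_pos: "0 < \<alpha>" and order_less_1: "\<alpha> < 1"
begin

text \<open>The constant in the argument of the Mittag-Leffler function is absorbed here, so that
  the series runs in powers of \<open>w powr (1 + \<alpha>)\<close>. Its sum
  \<open>sigma_factor\<close> is the entire function \<open>E\<close> of the overview.\<close>

definition sigma_coeff :: "nat \<Rightarrow> real" where
  "sigma_coeff n = mittag_leffler_coeff \<alpha> (1 + 1 / \<alpha>) 1 n * (- 1 / (1 + \<alpha>)) ^ n"

definition sigma_factor :: "real \<Rightarrow> real" where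
  "sigma_factor z = (\<Sum>n. sigma_coeff n * z ^ n)"

lemma ml_sigma_eq: "ml_sigma \<alpha> w = w powr (\<alpha> - 1) * sigma_factor (w powr (1 + \<alpha>))"
proof -
  have "(- (w powr (1 + \<alpha>)) / (1 + \<alpha>)) ^ n = (- 1 / (1 + \<alpha>)) ^ n * (w powr (1 + \<alpha>)) ^ n" for n
    by (simp flip: power_mult_distrib)
  then show ?thesis
    by (simp add: ml_sigma_def mittag_leffler_def sigma_factor_def sigma_coeff_def mult.assoc)
qed

lemma sigma_coeff_0 [simp]: "sigma_coeff 0 = 1"
  by (simp add: sigma_coeff_def mittag_leffler_coeff_def)

text \<open>With \<open>m = 1 + 1 / \<alpha>\<close> and \<open>l = 1\<close> the Gamma arguments
  become multiples of \<open>1 + \<alpha>\<close>, shifted by \<alpha> in the denominator. This form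
  is what cancels in \<open>frac_factor_has_derivative\<close>.\<close>

lemma sigma_coeff_Suc:
  "sigma_coeff (Suc n) = - sigma_coeff n / (1 + \<alpha>) *
     (Gamma ((1 + \<alpha>) * real (Suc n)) / Gamma ((1 + \<alpha>) * real (Suc n) + \<alpha>))"
proof -
  have "\<alpha> * (real n * (1 + 1 / \<alpha>) + 1) + 1 = (1 + \<alpha>) * real (Suc n)"
    "\<alpha> * (real n * (1 + 1 / \<alpha>) + 1 + 1) + 1 = (1 + \<alpha>) * real (Suc n) + \<alpha>"
    using order_pos by (simp_all add: field_simps)
  then show ?thesis
    by (simp add: sigma_coeff_def mittag_leffler_coeff_def mult_ac)
qed

text \<open>By \<open>Gamma_ratio_le\<close> the Gamma quotient in the recursion is at most of order
  \<open>n powr (- \<alpha>)\<close>, so the ratio test succeeds at every \<open>z\<close>.\<close>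

lemma summable_sigma: "summable (\<lambda>n. sigma_coeff n * z ^ n)"
proof -
  have "(\<lambda>n. ((1 + \<alpha>) * real (Suc n) + \<alpha> - 1) powr (- \<alpha>) * \<bar>z\<bar>) \<longlonglongrightarrow> 0"
    using order_pos by real_asymp
  then have "\<forall>\<^sub>F n in sequentially. ((1 + \<alpha>) * real (Suc n) + \<alpha> - 1) powr (- \<alpha>) * \<bar>z\<bar> < 1 / 2"
    by (rule order_tendstoD) simp
  then obtain N where N: "\<And>n. n \<ge> N \<Longrightarrow> ((1 + \<alpha>) * real (Suc n) + \<alpha> - 1) powr (- \<alpha>) * \<bar>z\<bar> < 1 / 2"
    by (auto simp: eventually_sequentially)
  show ?thesis
  proof (rule summable_ratio_test)
    fix n assume n: "n \<ge> N"
    define r where "r = Gamma ((1 + \<alpha>) * real (Suc n)) / Gamma ((1 + \<alpha>) * real (Suc n) + \<alpha>)"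
    have pos: "1 + \<alpha> \<le> (1 + \<alpha>) * real (Suc n)" using order_pos by simp
    have r: "0 \<le> r" unfolding r_def using pos order_pos by (intro divide_nonneg_nonneg less_imp_le Gamma_real_pos) linarith+
    have "r \<le> ((1 + \<alpha>) * real (Suc n) + \<alpha> - 1) powr (- \<alpha>)"
      unfolding r_def using order_pos order_less_1 pos by (intro Gamma_ratio_le) linarith+
    then have "r * \<bar>z\<bar> \<le> ((1 + \<alpha>) * real (Suc n) + \<alpha> - 1) powr (- \<alpha>) * \<bar>z\<bar>" by (rule mult_right_mono) simp
    with N[OF n] have le: "r * \<bar>z\<bar> \<le> 1 / 2" by linarith
    have "norm (sigma_coeff (Suc n) * z ^ Suc n)
        = norm (sigma_coeff n * z ^ n) / (1 + \<alpha>) * (r * \<bar>z\<bar>)"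
      using r order_pos unfolding sigma_coeff_Suc r_def [symmetric] by (simp add: abs_mult)
    also have "\<dots> \<le> norm (sigma_coeff n * z ^ n) * (1 / 2)"
      using order_pos le r by (intro mult_mono) (auto simp: divide_le_eq mult_left_le algebra_simps)
    finally show "norm (sigma_coeff (Suc n) * z ^ Suc n) \<le> 1 / 2 * norm (sigma_coeff n * z ^ n)"
      by simp
  qed simp
qed

lemma summable_norm_sigma: "summable (\<lambda>n. norm (sigma_coeff n * z ^ n))"
  by (rule powser_insidea[of _ "\<bar>z\<bar> + 1"]) (simp_all add: summable_sigma)

lemma sigma_factor_0 [simp]: "sigma_factor 0 = 1"
  using powser_zero[of sigma_coeff] by (simp add: sigma_factor_def)

lemma sigma_factor_has_derivative:
  "(sigma_factor has_real_derivative (\<Sum>n. diffs sigma_coeff n * z ^ n)) (at z)"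
  unfolding sigma_factor_def [abs_def]
  by (rule termdiffs_strong_converges_everywhere) (rule summable_sigma)

lemma isCont_sigma_factor: "isCont sigma_factor z"
  using sigma_factor_has_derivative DERIV_isCont by blast

lemma continuous_on_sigma_factor: "continuous_on S sigma_factor"
  by (simp add: isCont_sigma_factor continuous_at_imp_continuous_on)

lemma measurable_sigma_factor [measurable]: "sigma_factor \<in> borel_measurable borel"
  by (rule borel_measurable_continuous_onI) (rule continuous_on_sigma_factor)

lemma measurable_ml_sigma [measurable]: "ml_sigma \<alpha> \<in> borel_measurable borel"
  unfolding ml_sigma_eq [abs_def] by measurable

lemma ml_sigma_has_derivative:
  assumes "0 < x"
  shows "\<exists>D. (ml_sigma \<alpha> has_real_derivative D) (at x)"
proof -
  have "((\<lambda>w. sigma_factor (w powr (1 + \<alpha>))) has_real_derivative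
      (\<Sum>n. diffs sigma_coeff n * (x powr (1 + \<alpha>)) ^ n) * ((1 + \<alpha>) * x powr (1 + \<alpha> - 1))) (at x)"
    by (rule DERIV_chain2[OF sigma_factor_has_derivative]) (rule has_real_derivative_powr[OF assms])
  from DERIV_mult[OF has_real_derivative_powr[OF assms, of "\<alpha> - 1"] this]
  show ?thesis unfolding ml_sigma_eq [abs_def] by blast
qed

lemma isCont_ml_sigma: "0 < x \<Longrightarrow> isCont (ml_sigma \<alpha>) x"
  using ml_sigma_has_derivative DERIV_isCont by blast

section \<open>The fractional integral of the profile\<close>

text \<open>The Riemann-Liouville integral of order \<open>1 - \<alpha>\<close> sends
  \<open>w powr (\<alpha> - 1 + (1 + \<alpha>) * n)\<close> to this Gamma quotient times
  \<open>x powr ((1 + \<alpha>) * n)\<close>. The singular factor of the profile thus disappears,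
  and a power series in \<open>x powr (1 + \<alpha>)\<close> remains.\<close>

definition frac_coeff :: "nat \<Rightarrow> real" where
  "frac_coeff n = sigma_coeff n * (Gamma (\<alpha> + (1 + \<alpha>) * n) / Gamma (1 + (1 + \<alpha>) * n))"

definition frac_factor :: "real \<Rightarrow> real" where
  "frac_factor z = (\<Sum>n. frac_coeff n * z ^ n)"

lemma Gamma_mult_frac_coeff:
  "Gamma (1 - \<alpha>) * frac_coeff n = sigma_coeff n * Beta (\<alpha> + (1 + \<alpha>) * n) (1 - \<alpha>)"
  by (simp add: frac_coeff_def Beta_def add_ac)

text \<open>Absolute integrability is recorded together with the value, as the exchange of sum and
  integral in \<open>frac_sums\<close> requires it.\<close>

lemma has_bochner_integral_Beta:
  fixes a b :: real
  assumes "0 < a" "0 < b"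
  shows "has_bochner_integral lborel
           (\<lambda>t. indicator {0<..<1} t * (t powr (a - 1) * (1 - t) powr (b - 1))) (Beta a b)"
proof -
  have "set_integrable lborel {0<..<1} (\<lambda>t. t powr (a - 1) * (1 - t) powr (b - 1))"
    by (rule set_integrable_subset[OF integrable_Beta[OF assms]]) auto
  moreover have "((\<lambda>t. t powr (a - 1) * (1 - t) powr (b - 1)) has_integral Beta a b) {0<..<1}"
    using has_integral_Beta_real[OF assms] by (simp add: has_integral_Icc_iff_Ioo)
  ultimately show ?thesis
    using set_borel_integral_eq_integral(2)[of "{0<..<1}" "\<lambda>t. t powr (a - 1) * (1 - t) powr (b - 1)"]
    by (auto simp: has_bochner_integral_iff set_integrable_def set_lebesgue_integral_def integral_unique)
qed

text \<open>This is the fractional integral of the profile rescaled to the unit interval, with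
  \<open>z\<close> in the role of \<open>x powr (1 + \<alpha>)\<close>. Each monomial contributes a
  Beta value, and the exchange is justified by summability of the integrals of the absolute
  values.\<close>

lemma frac_sums:
  assumes "0 \<le> z"
  shows "integrable lborel (\<lambda>t. indicator {0<..<1} t *
           (t powr (\<alpha> - 1) * (1 - t) powr (- \<alpha>) * sigma_factor (z * t powr (1 + \<alpha>))))" (is "integrable _ ?g")
    and "(\<lambda>n. Gamma (1 - \<alpha>) * frac_coeff n * z ^ n) sums
           (\<integral>t. indicator {0<..<1} t *
             (t powr (\<alpha> - 1) * (1 - t) powr (- \<alpha>) * sigma_factor (z * t powr (1 + \<alpha>))) \<partial>lborel)"
proof -
  let ?b = "\<lambda>n::nat. Beta (\<alpha> + (1 + \<alpha>) * n) (1 - \<alpha>)"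
  define f where "f n t = sigma_coeff n * z ^ n *
     (indicator {0<..<1} t * (t powr (\<alpha> + (1 + \<alpha>) * n - 1) * (1 - t) powr (1 - \<alpha> - 1)))" for n and t :: real
  have f_hbi: "has_bochner_integral lborel (f n) (sigma_coeff n * z ^ n * ?b n)" for n
    unfolding f_def using order_pos order_less_1
    by (intro has_bochner_integral_mult_right has_bochner_integral_Beta) (auto intro: add_pos_nonneg)
  have fn_hbi: "has_bochner_integral lborel (\<lambda>t. norm (f n t)) (norm (sigma_coeff n * z ^ n) * ?b n)" for n
  proof -
    have "norm (f n t) = norm (sigma_coeff n * z ^ n) *
      (indicator {0<..<1} t * (t powr (\<alpha> + (1 + \<alpha>) * n - 1) * (1 - t) powr (1 - \<alpha> - 1)))" for t
      by (simp add: f_def abs_mult)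
    then show ?thesis using order_pos order_less_1
      by (simp only:, intro has_bochner_integral_mult_right has_bochner_integral_Beta)
        (auto intro: add_pos_nonneg)
  qed
  have f_eq: "f n t = indicator {0<..<1} t * (t powr (\<alpha> - 1) * (1 - t) powr (- \<alpha>)) *
      (sigma_coeff n * (z * t powr (1 + \<alpha>)) ^ n)" for n t
  proof (cases "t \<in> {0<..<1}")
    case True
    have "t powr (\<alpha> + (1 + \<alpha>) * n - 1) = t powr (\<alpha> - 1) * t powr ((1 + \<alpha>) * n)"
      by (simp flip: powr_add add: algebra_simps)
    also have "t powr ((1 + \<alpha>) * n) = (t powr (1 + \<alpha>)) ^ n"
      using True by (simp add: powr_powr flip: powr_realpow)
    finally show ?thesis by (simp add: f_def power_mult_distrib mult_ac)
  qed (simp add: f_def)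
  have f_sum: "(\<Sum>n. f n t) = ?g t" for t
    unfolding f_eq sigma_factor_def
    by (simp add: suminf_mult summable_sigma mult.assoc)
  have summ: "summable (\<lambda>n. norm (f n t))" for t
  proof -
    have "summable (\<lambda>n. norm (indicator {0<..<1} t * (t powr (\<alpha> - 1) * (1 - t) powr (- \<alpha>))) *
        norm (sigma_coeff n * (z * t powr (1 + \<alpha>)) ^ n))"
      by (intro summable_mult summable_norm_sigma)
    then show ?thesis unfolding f_eq norm_mult[of "_ * (_ * _)"] by simp
  qed
  \<comment> \<open>Beta decreases in its first argument, so all Beta factors are bounded by the one
    for \<open>n = 0\<close>; absolute convergence of the series of \<open>sigma_factor\<close> does
    the rest.\<close>
  have summ2: "summable (\<lambda>n. \<integral>t. norm (f n t) \<partial>lborel)"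
  proof (rule summable_comparison_test')
    show "summable (\<lambda>n. norm (sigma_coeff n * z ^ n) * Beta \<alpha> (1 - \<alpha>))"
      by (intro summable_mult2 summable_norm_sigma)
    fix n :: nat
    have "0 < \<alpha> + (1 + \<alpha>) * n" using order_pos by (intro add_pos_nonneg) auto
    then have "0 \<le> ?b n"
      using order_less_1 unfolding Beta_def
      by (intro divide_nonneg_nonneg mult_nonneg_nonneg less_imp_le[OF Gamma_real_pos]) auto
    moreover have "?b n \<le> Beta \<alpha> (1 - \<alpha>)"
      using order_pos order_less_1 by (intro Beta_real_mono) auto
    ultimately show "norm (\<integral>t. norm (f n t) \<partial>lborel) \<le> norm (sigma_coeff n * z ^ n) * Beta \<alpha> (1 - \<alpha>)"
      using fn_hbi[of n] by (auto simp: has_bochner_integral_iff abs_mult intro!: mult_left_mono)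
  qed
  have "integrable lborel (\<lambda>t. \<Sum>n. f n t)"
    using f_hbi summ summ2 by (intro integrable_suminf) (auto simp: has_bochner_integral_iff)
  then show "integrable lborel ?g" by (simp only: f_sum)
  have "(\<lambda>n. integral\<^sup>L lborel (f n)) sums (\<integral>t. (\<Sum>n. f n t) \<partial>lborel)"
    using f_hbi summ summ2 by (intro sums_integral) (auto simp: has_bochner_integral_iff)
  then show "(\<lambda>n. Gamma (1 - \<alpha>) * frac_coeff n * z ^ n) sums (\<integral>t. ?g t \<partial>lborel)"
    using f_hbi unfolding f_sum has_bochner_integral_iff Gamma_mult_frac_coeff
    by (simp add: mult_ac)
qed

text \<open>Convergence is a by-product of termwise integration: \<open>frac_sums\<close> yields it
  at \<open>\<bar>z\<bar> + 1\<close>, which is nonnegative and of larger modulus than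
  \<open>z\<close>.\<close>

lemma summable_frac: "summable (\<lambda>n. frac_coeff n * z ^ n)"
proof -
  have "summable (\<lambda>n. Gamma (1 - \<alpha>) * (frac_coeff n * (\<bar>z\<bar> + 1) ^ n))"
    using frac_sums(2)[of "\<bar>z\<bar> + 1"] by (simp add: sums_iff mult.assoc)
  moreover have "Gamma (1 - \<alpha>) \<noteq> 0"
    using order_less_1 Gamma_real_pos[of "1 - \<alpha>"] by linarith
  ultimately have "summable (\<lambda>n. frac_coeff n * (\<bar>z\<bar> + 1) ^ n)"
    by (simp add: summable_cmult_iff)
  from powser_insidea[OF this, of z] show ?thesis by (simp add: summable_norm_cancel)
qed

lemma frac_factor_0 [simp]: "frac_factor 0 = Gamma \<alpha>"
  using powser_zero[of frac_coeff] by (simp add: frac_factor_def frac_coeff_def)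

text \<open>Put \<open>m = (1 + \<alpha>) * (n + 1)\<close>. The quotient of \<open>Gamma m\<close>
  and \<open>Gamma (\<alpha> + m)\<close> from the recursion meets that of
  \<open>Gamma (\<alpha> + m)\<close> and \<open>Gamma (1 + m)\<close> from the Beta integral and
  leaves \<open>1 / m\<close>, whose factor \<open>n + 1\<close> is cancelled by differentiation.
  The series of \<open>sigma_factor\<close> reappears.\<close>

lemma frac_factor_has_derivative:
  "(frac_factor has_real_derivative - sigma_factor z / (1 + \<alpha>)\<^sup>2) (at z)"
proof -
  have "diffs frac_coeff n = - 1 / (1 + \<alpha>)\<^sup>2 * sigma_coeff n" for n
  proof -
    let ?m = "(1 + \<alpha>) * real (Suc n)"
    have m: "0 < ?m" using order_pos by simp
    then have G: "Gamma (1 + ?m) = ?m * Gamma ?m"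
      using Gamma_plus1[of ?m] by (force dest!: nonpos_Ints_nonpos simp: add_ac)
    have "Gamma ?m \<noteq> 0" "Gamma (\<alpha> + ?m) \<noteq> 0"
      using Gamma_real_pos[OF m] Gamma_real_pos[of "\<alpha> + ?m"] m order_pos by linarith+
    then have "sigma_coeff (Suc n) * (Gamma (\<alpha> + ?m) / Gamma (1 + ?m)) = - sigma_coeff n / (1 + \<alpha>) / ?m"
      unfolding sigma_coeff_Suc G by (simp add: add_ac)
    then have "diffs frac_coeff n = real (Suc n) * (- sigma_coeff n / (1 + \<alpha>) / ?m)"
      unfolding diffs_def frac_coeff_def by simp
    also have "\<dots> = - 1 / (1 + \<alpha>)\<^sup>2 * sigma_coeff n"
      by (simp add: power2_eq_square)
    finally show ?thesis .
  qed
  then have "(\<Sum>n. diffs frac_coeff n * z ^ n) = - 1 / (1 + \<alpha>)\<^sup>2 * sigma_factor z"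
    unfolding sigma_factor_def by (subst suminf_mult [OF summable_sigma, symmetric]) (simp add: mult.assoc)
  then show ?thesis
    unfolding frac_factor_def [abs_def]
    using termdiffs_strong_converges_everywhere[of frac_coeff z] summable_frac by simp
qed

text \<open>Up to the factor \<open>\<Gamma>(1 - \<alpha>)\<close>, \<open>frac_int\<close> is the Riemann-Liouville integral of order
  \<open>1 - \<alpha>\<close> of \<open>\<sigma>\<^sub>\<alpha>\<close>.\<close>

definition frac_int :: "real \<Rightarrow> real" where
  "frac_int x = frac_factor (x powr (1 + \<alpha>))"

lemma frac_int_0 [simp]: "frac_int 0 = Gamma \<alpha>"
  by (simp add: frac_int_def)

text \<open>The fractional differential equation of the profile. The diffusion equation, the moment
  formula and the maximum principle all rest on it.\<close>

lemma frac_int_has_derivative: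
  assumes "0 < x"
  shows "(frac_int has_real_derivative - x * ml_sigma \<alpha> x / (1 + \<alpha>)) (at x)"
proof -
  have "((\<lambda>w. frac_factor (w powr (1 + \<alpha>))) has_real_derivative
      (- sigma_factor (x powr (1 + \<alpha>)) / (1 + \<alpha>)\<^sup>2) * ((1 + \<alpha>) * x powr (1 + \<alpha> - 1))) (at x)"
    by (rule DERIV_chain2[OF frac_factor_has_derivative]) (rule has_real_derivative_powr[OF assms])
  moreover have "x powr (1 + \<alpha> - 1) = x * x powr (\<alpha> - 1)"
    using assms by (simp add: powr_diff)
  ultimately show ?thesis
    using order_pos by (simp add: frac_int_def [abs_def] ml_sigma_eq power2_eq_square mult_ac)
qed

lemma continuous_on_frac_int: "continuous_on {0..} frac_int"
proof -
  have "continuous_on UNIV frac_factor"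
    using frac_factor_has_derivative DERIV_isCont by (blast intro: continuous_at_imp_continuous_on)
  moreover have "continuous_on {0..} (\<lambda>x::real. x powr (1 + \<alpha>))"
    using order_pos by (intro continuous_on_powr') (auto intro: continuous_intros)
  ultimately show ?thesis
    unfolding frac_int_def [abs_def] by (rule continuous_on_compose2) simp
qed

lemma frac_int_tendsto_0: "(frac_int \<longlongrightarrow> Gamma \<alpha>) (at_right 0)"
proof -
  have "(frac_int \<longlongrightarrow> frac_int 0) (at 0 within {0..})"
    using continuous_on_frac_int by (simp only: continuous_on_def atLeast_iff order_refl)
  then show ?thesis
    unfolding frac_int_0 by (rule tendsto_within_subset) auto
qed

text \<open>The substitution \<open>w = x * v\<close> reduces the integral to the one on the unit
  interval evaluated in \<open>frac_sums\<close>.\<close>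

lemma has_bochner_integral_frac_int:
  assumes "0 < x"
  shows "has_bochner_integral lborel
           (\<lambda>w. indicator {0<..<x} w * (ml_sigma \<alpha> w / (x - w) powr \<alpha>)) (Gamma (1 - \<alpha>) * frac_int x)"
proof -
  define g where "g t = indicator {0<..<1} t *
    (t powr (\<alpha> - 1) * (1 - t) powr (- \<alpha>) * sigma_factor (x powr (1 + \<alpha>) * t powr (1 + \<alpha>)))" for t :: real
  have "(\<integral>t. g t \<partial>lborel) = Gamma (1 - \<alpha>) * frac_int x"
    using sums_unique2[OF frac_sums(2)[of "x powr (1 + \<alpha>)"]
      sums_mult[OF summable_sums[OF summable_frac[of "x powr (1 + \<alpha>)"]], of "Gamma (1 - \<alpha>)",
        unfolded mult.assoc [symmetric]]]
    unfolding g_def frac_int_def frac_factor_def by simp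
  then have g: "has_bochner_integral lborel g (Gamma (1 - \<alpha>) * frac_int x)"
    using frac_sums(1)[of "x powr (1 + \<alpha>)"] unfolding has_bochner_integral_iff g_def [abs_def] by simp
  \<comment> \<open>The profile contributes \<open>x powr (\<alpha> - 1)\<close> and the kernel
    \<open>x powr (- \<alpha>)\<close>; the resulting \<open>1 / x\<close> is compensated by the
    Jacobian.\<close>
  have "indicator {0<..<x} (0 + x * v) * (ml_sigma \<alpha> (0 + x * v) / (x - (0 + x * v)) powr \<alpha>) = (1 / x) * g v" for v
  proof (cases "v \<in> {0<..<1}")
    case True
    have "(x - x * v) powr \<alpha> = x powr \<alpha> * (1 - v) powr \<alpha>"
      using assms True by (simp add: right_diff_distrib flip: powr_mult)
    moreover have "(x * v) powr (\<alpha> - 1) = x powr \<alpha> / x * v powr (\<alpha> - 1)"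
      using assms True by (simp add: powr_mult powr_diff)
    ultimately show ?thesis
      using assms True by (simp add: ml_sigma_eq g_def powr_mult powr_minus field_simps)
  next
    case False
    then have "x * v \<notin> {0<..<x}"
      using assms by (auto simp: zero_less_mult_iff)
    then show ?thesis using False by (simp add: g_def)
  qed
  moreover have "has_bochner_integral lborel (\<lambda>v. (1 / x) * g v) ((1 / x) * (Gamma (1 - \<alpha>) * frac_int x))"
    by (intro has_bochner_integral_mult_right g)
  ultimately show ?thesis
    using assms by (subst lborel_has_bochner_integral_real_affine_iff[of x _ _ 0])
      (simp_all add: divide_inverse mult_ac)
qed

section \<open>Integral and first moment of the profile\<close>

lemma interval_lborel_0:
  fixes x :: real
  assumes "0 < x"
  shows "interval_lebesgue_integrable lborel 0 (ereal x) f \<longleftrightarrow> set_integrable lborel {0<..<x} f"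
    and "interval_lebesgue_integral lborel 0 (ereal x) f = set_lebesgue_integral lborel {0<..<x} f"
  using assms by (simp_all add: interval_lebesgue_integrable_def interval_lebesgue_integral_def zero_ereal_def)

text \<open>On the interval the kernel is at least \<open>x powr (- \<alpha>)\<close>, so the
  profile is dominated by \<open>x powr \<alpha>\<close> times the integrable weighted
  profile.\<close>

lemma set_integrable_ml_sigma:
  assumes "0 < x"
  shows "set_integrable lborel {0<..<x} (ml_sigma \<alpha>)"
  unfolding set_integrable_def
proof (rule Bochner_Integration.integrable_bound)
  show "integrable lborel (\<lambda>w. x powr \<alpha> * (indicator {0<..<x} w * (ml_sigma \<alpha> w / (x - w) powr \<alpha>)))"
    using has_bochner_integral_frac_int[OF assms] by (intro integrable_mult_right) (simp add: has_bochner_integral_iff)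
  show "AE w in lborel. norm (indicator {0<..<x} w *\<^sub>R ml_sigma \<alpha> w)
      \<le> norm (x powr \<alpha> * (indicator {0<..<x} w * (ml_sigma \<alpha> w / (x - w) powr \<alpha>)))"
  proof (intro AE_I2)
    fix w
    show "norm (indicator {0<..<x} w *\<^sub>R ml_sigma \<alpha> w)
      \<le> norm (x powr \<alpha> * (indicator {0<..<x} w * (ml_sigma \<alpha> w / (x - w) powr \<alpha>)))"
    proof (cases "w \<in> {0<..<x}")
      case True
      then have "(x - w) powr \<alpha> \<le> x powr \<alpha>" "0 < (x - w) powr \<alpha>"
        using order_pos by (auto intro!: powr_mono2)
      then have "\<bar>ml_sigma \<alpha> w\<bar> * (x - w) powr \<alpha> \<le> \<bar>ml_sigma \<alpha> w\<bar> * x powr \<alpha>"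
        by (intro mult_left_mono) auto
      then show ?thesis using True \<open>0 < (x - w) powr \<alpha>\<close> by (simp add: abs_mult field_simps)
    qed simp
  qed
qed simp

definition sigma_int :: "real \<Rightarrow> real" where
  "sigma_int x = (LBINT w=0..ereal x. ml_sigma \<alpha> w)"

lemma has_bochner_integral_sigma_int:
  assumes "0 < x"
  shows "has_bochner_integral lborel (\<lambda>w. indicator {0<..<x} w * ml_sigma \<alpha> w) (sigma_int x)"
  using set_integrable_ml_sigma[OF assms] interval_lborel_0(2)[OF assms, of "ml_sigma \<alpha>"]
  by (simp add: has_bochner_integral_iff sigma_int_def set_integrable_def set_lebesgue_integral_def)

text \<open>The profile is unbounded near 0, so the fundamental theorem is applied from the base
  point \<open>c\<close>, and the integral up to \<open>c\<close> is split off as a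
  constant.\<close>

lemma sigma_int_has_derivative:
  assumes "0 < x"
  shows "(sigma_int has_real_derivative ml_sigma \<alpha> x) (at x)"
proof -
  define c where "c = x / 2"
  have c: "0 < c" "c < x" "x < 2 * x" using assms by (auto simp: c_def)
  have "((\<lambda>u. LBINT y=c..u. ml_sigma \<alpha> y) has_vector_derivative ml_sigma \<alpha> x) (at x within {c..2 * x})"
    using c by (intro interval_integral_FTC2) (auto intro!: continuous_at_imp_continuous_on isCont_ml_sigma)
  then have "((\<lambda>u. LBINT y=c..u. ml_sigma \<alpha> y) has_real_derivative ml_sigma \<alpha> x) (at x)"
    using c by (simp add: has_real_derivative_iff_has_vector_derivative at_within_Icc_at)
  then have "((\<lambda>u. sigma_int c + (LBINT y=c..u. ml_sigma \<alpha> y)) has_real_derivative ml_sigma \<alpha> x) (at x)"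
    by (auto intro!: derivative_eq_intros)
  then show ?thesis
  proof (rule has_field_derivative_transform_within_open)
    fix u assume "u \<in> {c<..}"
    then have u: "0 < u" "c < u" using c by auto
    then have "min 0 (min (ereal c) (ereal u)) = 0" "max 0 (max (ereal c) (ereal u)) = ereal u"
      using c by (simp_all add: min_def max_def)
    then show "sigma_int c + (LBINT y=c..u. ml_sigma \<alpha> y) = sigma_int u"
      unfolding sigma_int_def using u set_integrable_ml_sigma[of u]
      by (intro interval_integral_sum) (simp add: interval_lborel_0)
  qed (use c in auto)
qed

text \<open>By \<open>frac_int_has_derivative\<close> the integrand is the derivative of
  \<open>- (1 + \<alpha>) * frac_int w\<close>. The formula simplifies the numerator of
  \<open>H_fun\<close>.\<close>

lemma ml_sigma_moment:
  assumes "0 < x"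
  shows "(LBINT w=0..ereal x. w * ml_sigma \<alpha> w) = (1 + \<alpha>) * (Gamma \<alpha> - frac_int x)"
proof -
  have "(LBINT w=0..ereal x. w * ml_sigma \<alpha> w) = - (1 + \<alpha>) * frac_int x - (- (1 + \<alpha>) * Gamma \<alpha>)"
  proof (rule interval_integral_FTC_integrable[where F = "\<lambda>w. - (1 + \<alpha>) * frac_int w"])
    fix w assume "0 < ereal w" "ereal w < ereal x"
    then have w: "0 < w" by (simp add: zero_ereal_def)
    show "((\<lambda>w. - (1 + \<alpha>) * frac_int w) has_vector_derivative w * ml_sigma \<alpha> w) (at w)"
    proof -
      have "- (1 + \<alpha>) * (- w * ml_sigma \<alpha> w / (1 + \<alpha>)) = w * ml_sigma \<alpha> w"
        using order_pos by (simp add: field_simps)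
      then show ?thesis
        using DERIV_cmult[OF frac_int_has_derivative[OF w], of "- (1 + \<alpha>)"]
        by (simp only: has_real_derivative_iff_has_vector_derivative)
    qed
    show "isCont (\<lambda>w. w * ml_sigma \<alpha> w) w"
      using isCont_ml_sigma[OF w] by (intro continuous_intros)
  next
    have "set_integrable lborel {0<..<x} (\<lambda>w. w * ml_sigma \<alpha> w)"
      unfolding set_integrable_def
    proof (rule Bochner_Integration.integrable_bound)
      show "integrable lborel (\<lambda>w. x * (indicator {0<..<x} w * ml_sigma \<alpha> w))"
        using has_bochner_integral_sigma_int[OF assms]
        by (intro integrable_mult_right) (simp add: has_bochner_integral_iff)
    qed (auto simp: indicator_def abs_mult intro!: mult_right_mono AE_I2)
    then show "set_integrable lborel (einterval 0 (ereal x)) (\<lambda>w. w * ml_sigma \<alpha> w)"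
      by (simp add: zero_ereal_def)
    have "((\<lambda>w. - (1 + \<alpha>) * frac_int w) \<longlongrightarrow> - (1 + \<alpha>) * Gamma \<alpha>) (at_right 0)"
      by (intro tendsto_intros frac_int_tendsto_0)
    then show "(((\<lambda>w. - (1 + \<alpha>) * frac_int w) \<circ> real_of_ereal) \<longlongrightarrow> - (1 + \<alpha>) * Gamma \<alpha>) (at_right 0)"
      by (simp add: zero_ereal_def ereal_tendsto_simps)
    have "isCont frac_int x" using frac_int_has_derivative[OF assms] DERIV_isCont by blast
    then have "((\<lambda>w. - (1 + \<alpha>) * frac_int w) \<longlongrightarrow> - (1 + \<alpha>) * frac_int x) (at_left x)"
      by (intro tendsto_intros) (auto simp: isCont_def intro: tendsto_within_subset)
    then show "(((\<lambda>w. - (1 + \<alpha>) * frac_int w) \<circ> real_of_ereal) \<longlongrightarrow> - (1 + \<alpha>) * frac_int x) (at_left (ereal x))"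
      by (simp add: ereal_tendsto_simps)
  qed (use assms in \<open>auto simp: zero_ereal_def\<close>)
  then show ?thesis by (simp add: algebra_simps)
qed

text \<open>Here and in the next two lemmas the sign of the profile is a local hypothesis, because
  the maximum principle uses them before the sign is known everywhere.\<close>

lemma sigma_int_nonneg:
  assumes "0 < x" and "\<And>w. 0 < w \<Longrightarrow> w < x \<Longrightarrow> 0 \<le> ml_sigma \<alpha> w"
  shows "0 \<le> sigma_int x"
  unfolding has_bochner_integral_integral_eq[OF has_bochner_integral_sigma_int[OF assms(1)], symmetric]
  using assms(2) by (intro integral_nonneg_AE AE_I2) (auto simp: indicator_def)

lemma sigma_int_less:
  assumes "0 < a" "a < b" and "\<And>w. a < w \<Longrightarrow> w < b \<Longrightarrow> 0 < ml_sigma \<alpha> w"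
  shows "sigma_int a < sigma_int b"
proof (rule DERIV_pos_imp_increasing_open[OF assms(2)])
  show "\<exists>y. (sigma_int has_real_derivative y) (at w) \<and> 0 < y" if "a < w" "w < b" for w
    using that assms sigma_int_has_derivative[of w] by auto
  show "continuous_on {a..b} sigma_int"
    using assms(1) by (intro continuous_at_imp_continuous_on ballI DERIV_isCont[OF sigma_int_has_derivative]) auto
qed

text \<open>Strict growth is available between positive points only, hence the detour through
  \<open>x / 2\<close>.\<close>

lemma sigma_int_pos:
  assumes "0 < x" and "\<And>w. 0 < w \<Longrightarrow> w < x \<Longrightarrow> 0 < ml_sigma \<alpha> w"
  shows "0 < sigma_int x"
proof -
  have "0 \<le> sigma_int (x / 2)"
    using assms by (intro sigma_int_nonneg less_imp_le[OF assms(2)]) auto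
  also have "\<dots> < sigma_int x"
    using assms by (intro sigma_int_less) auto
  finally show ?thesis .
qed

section \<open>Positivity of the profile by a maximum principle\<close>

text \<open>By the mean value theorem, since the slope of \<open>z powr (- \<alpha>)\<close> is at
  most \<open>- \<alpha> * b powr (- \<alpha> - 1)\<close> for positive \<open>z\<close> up to
  \<open>b\<close>.\<close>

lemma powr_neg_decrease:
  fixes r s :: real
  assumes "0 < r" "r < s" "s \<le> b"
  shows "s powr (- \<alpha>) \<le> r powr (- \<alpha>) - \<alpha> * b powr (- \<alpha> - 1) * (s - r)"
proof -
  have "((\<lambda>z. z powr (- \<alpha>)) has_real_derivative - \<alpha> * z powr (- \<alpha> - 1)) (at z)"
    if "r \<le> z" "z \<le> s" for z
    using that assms by (intro has_real_derivative_powr) auto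
  from MVT2[OF assms(2) this] obtain z where z: "r < z" "z < s"
    and eq: "s powr (- \<alpha>) - r powr (- \<alpha>) = (s - r) * (- \<alpha> * z powr (- \<alpha> - 1))"
    by blast
  have "b powr (- \<alpha> - 1) \<le> z powr (- \<alpha> - 1)"
    using z assms order_pos by (intro powr_mono2') auto
  then have "(s - r) * (\<alpha> * b powr (- \<alpha> - 1)) \<le> (s - r) * (\<alpha> * z powr (- \<alpha> - 1))"
    using assms order_pos by (intro mult_left_mono) auto
  with eq show ?thesis by (simp add: algebra_simps)
qed

text \<open>The integrals at \<open>x\<close> and \<open>x - h\<close> are compared pointwise. Left
  of \<open>x - h\<close> the kernel drops by at least a fixed multiple of \<open>h\<close>; on the
  last stretch of length \<open>h\<close> the weighted profile is at most
  \<open>C * h powr (1 - \<alpha>)\<close>. The gain is linear in \<open>h\<close>, the loss of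
  higher order.\<close>

lemma frac_int_backward_estimate:
  assumes "0 < h" "h < x" "0 \<le> C"
    and nonneg: "\<And>w. 0 < w \<Longrightarrow> w < x \<Longrightarrow> 0 \<le> ml_sigma \<alpha> w"
    and small: "\<And>w. x - h \<le> w \<Longrightarrow> w < x \<Longrightarrow> ml_sigma \<alpha> w \<le> C * (x - w)"
  shows "Gamma (1 - \<alpha>) * frac_int x \<le> Gamma (1 - \<alpha>) * frac_int (x - h)
           - \<alpha> * x powr (- \<alpha> - 1) * h * sigma_int (x - h) + C * h powr (1 - \<alpha>) * h"
proof -
  define \<kappa> where "\<kappa> = \<alpha> * x powr (- \<alpha> - 1)"
  define y where "y = x - h"
  have y: "0 < y" "y < x" using assms by (auto simp: y_def)
  let ?f = "\<lambda>w. indicator {0<..<x} w * (ml_sigma \<alpha> w / (x - w) powr \<alpha>)"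
  let ?g = "\<lambda>w. indicator {0<..<y} w * (ml_sigma \<alpha> w / (y - w) powr \<alpha>)
      - \<kappa> * h * (indicator {0<..<y} w * ml_sigma \<alpha> w) + C * h powr (1 - \<alpha>) * indicator {y..<x} w"
  have f: "has_bochner_integral lborel ?f (Gamma (1 - \<alpha>) * frac_int x)"
    using y by (intro has_bochner_integral_frac_int) auto
  have "has_bochner_integral lborel (indicator {y..<x} :: real \<Rightarrow> real) h"
    using has_bochner_integral_real_indicator[of "{y..<x}" lborel] y by (simp add: y_def)
  then have g: "has_bochner_integral lborel ?g (Gamma (1 - \<alpha>) * frac_int y
      - \<kappa> * h * sigma_int y + C * h powr (1 - \<alpha>) * h)"
    by (intro has_bochner_integral_add has_bochner_integral_diff has_bochner_integral_mult_right
        has_bochner_integral_frac_int has_bochner_integral_sigma_int y)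
  have "?f w \<le> ?g w" for w
  proof -
    consider "w \<notin> {0<..<x}" | "0 < w" "w < y" | "y \<le> w" "w < x" by force
    then show ?thesis
    proof cases
      case 1
      then show ?thesis using y by (auto simp: indicator_def)
    next
      case 2
      have "(x - w) powr (- \<alpha>) \<le> (y - w) powr (- \<alpha>) - \<kappa> * ((x - w) - (y - w))"
        unfolding \<kappa>_def using 2 y by (intro powr_neg_decrease) auto
      then have "ml_sigma \<alpha> w * (x - w) powr (- \<alpha>) \<le> ml_sigma \<alpha> w * ((y - w) powr (- \<alpha>) - \<kappa> * h)"
        using 2 y nonneg[of w] by (intro mult_left_mono) (auto simp: y_def)
      then show ?thesis using 2 y by (simp add: powr_minus_divide algebra_simps)
    next
      case 3
      have "ml_sigma \<alpha> w / (x - w) powr \<alpha> \<le> C * (x - w) / (x - w) powr \<alpha>"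
        using small[of w] 3 by (intro divide_right_mono) (auto simp: y_def)
      also have "\<dots> = C * (x - w) powr (1 - \<alpha>)"
        using 3 by (simp add: powr_diff)
      also have "\<dots> \<le> C * h powr (1 - \<alpha>)"
        using 3 assms(3) order_less_1 by (intro mult_left_mono powr_mono2) (auto simp: y_def)
      finally show ?thesis using 3 y by simp
    qed
  qed
  then have "(\<integral>w. ?f w \<partial>lborel) \<le> (\<integral>w. ?g w \<partial>lborel)"
    using f g by (intro integral_mono) (auto simp: has_bochner_integral_iff)
  then have "Gamma (1 - \<alpha>) * frac_int x
      \<le> Gamma (1 - \<alpha>) * frac_int y - \<kappa> * h * sigma_int y + C * h powr (1 - \<alpha>) * h"
    by (simp only: has_bochner_integral_integral_eq[OF f] has_bochner_integral_integral_eq[OF g])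
  then show ?thesis by (simp only: \<kappa>_def y_def)
qed

lemma DERIV_approx:
  fixes f :: "real \<Rightarrow> real"
  assumes "(f has_real_derivative D) (at x)" "0 < e"
  obtains d where "0 < d" "\<And>y. \<bar>y - x\<bar> < d \<Longrightarrow> \<bar>f y - f x - D * (y - x)\<bar> \<le> e * \<bar>y - x\<bar>"
  using assms unfolding has_field_derivative_def has_derivative_at_alt by auto

text \<open>A maximum principle: at a first zero \<open>x\<close> of \<open>\<sigma>\<^sub>\<alpha>\<close> the derivative of the fractional integral
  would be strictly negative, whereas it equals \<open>- x \<sigma>\<^sub>\<alpha>(x) / (1 + \<alpha>) = 0\<close>.\<close>

lemma ml_sigma_no_first_zero:
  assumes "0 < x" and pos: "\<And>w. 0 < w \<Longrightarrow> w < x \<Longrightarrow> 0 < ml_sigma \<alpha> w"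
  shows "ml_sigma \<alpha> x \<noteq> 0"
proof
  assume zero: "ml_sigma \<alpha> x = 0"
  obtain D where "(ml_sigma \<alpha> has_real_derivative D) (at x)"
    using ml_sigma_has_derivative[OF assms(1)] by blast
  then obtain d where d: "0 < d"
    "\<And>y. \<bar>y - x\<bar> < d \<Longrightarrow> \<bar>ml_sigma \<alpha> y - ml_sigma \<alpha> x - D * (y - x)\<bar> \<le> 1 * \<bar>y - x\<bar>"
    by (rule DERIV_approx[where e = 1]) auto
  \<comment> \<open>As the profile vanishes at \<open>x\<close> with derivative \<open>D\<close>, it
    stays below \<open>C * (x - w)\<close> just left of \<open>x\<close>.\<close>
  define C where "C = \<bar>D\<bar> + 1"
  have small: "ml_sigma \<alpha> w \<le> C * (x - w)" if "x - d < w" "w < x" for w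
  proof -
    have "ml_sigma \<alpha> w \<le> (- D) * (x - w) + (x - w)"
      using d(2)[of w] that zero by (simp add: algebra_simps)
    also have "\<dots> \<le> \<bar>D\<bar> * (x - w) + (x - w)"
      using that by (intro add_right_mono mult_right_mono) auto
    finally show ?thesis by (simp add: C_def algebra_simps)
  qed
  \<comment> \<open>The linear drop is at least \<open>3 * \<epsilon> * h\<close>, because
    \<open>h < x / 2\<close> keeps \<open>sigma_int (x - h)\<close> above
    \<open>sigma_int (x / 2)\<close>. The zero derivative and the last stretch each offset at most
    \<open>\<epsilon> * h\<close>, a contradiction.\<close>
  define \<epsilon> where "\<epsilon> = \<alpha> * x powr (- \<alpha> - 1) * sigma_int (x / 2) / 3"
  have "0 < sigma_int (x / 2)" using assms by (intro sigma_int_pos) auto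
  then have \<epsilon>: "0 < \<epsilon>" using assms order_pos by (simp add: \<epsilon>_def)
  have "((\<lambda>x. Gamma (1 - \<alpha>) * frac_int x) has_real_derivative 0) (at x)"
    using DERIV_cmult[OF frac_int_has_derivative[OF assms(1)], of "Gamma (1 - \<alpha>)"] zero by simp
  then obtain d' where d': "0 < d'"
    "\<And>y. \<bar>y - x\<bar> < d' \<Longrightarrow> \<bar>Gamma (1 - \<alpha>) * frac_int y - Gamma (1 - \<alpha>) * frac_int x - 0 * (y - x)\<bar> \<le> \<epsilon> * \<bar>y - x\<bar>"
    by (rule DERIV_approx[OF _ \<epsilon>]) auto
  have "((\<lambda>h. C * h powr (1 - \<alpha>)) \<longlongrightarrow> 0) (at_right 0)"
    using order_less_1 by real_asymp
  then have "\<forall>\<^sub>F h in at_right 0. C * h powr (1 - \<alpha>) < \<epsilon>"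
    using \<epsilon> by (rule order_tendstoD)
  moreover have "\<forall>\<^sub>F h in at_right 0. h < min (x / 2) (min d d')"
    using assms d(1) d'(1) by (intro eventually_at_rightI[of 0 "min (x / 2) (min d d')"]) auto
  moreover have "\<forall>\<^sub>F h in at_right (0 :: real). 0 < h"
    by (rule eventually_at_right_less)
  ultimately have "\<forall>\<^sub>F h in at_right 0. C * h powr (1 - \<alpha>) < \<epsilon> \<and> h < min (x / 2) (min d d') \<and> 0 < h"
    by eventually_elim auto
  from eventually_happens[OF this] obtain h where
    h: "C * h powr (1 - \<alpha>) < \<epsilon>" "h < x / 2" "h < d" "h < d'" "0 < h" by auto
  have "Gamma (1 - \<alpha>) * frac_int x \<le> Gamma (1 - \<alpha>) * frac_int (x - h)
           - \<alpha> * x powr (- \<alpha> - 1) * h * sigma_int (x - h) + C * h powr (1 - \<alpha>) * h"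
    using h pos small assms(1) by (intro frac_int_backward_estimate) (auto simp: C_def intro: less_imp_le)
  moreover have "Gamma (1 - \<alpha>) * frac_int (x - h) - Gamma (1 - \<alpha>) * frac_int x \<le> \<epsilon> * h"
    using d'(2)[of "x - h"] h by simp
  moreover have "C * h powr (1 - \<alpha>) * h \<le> \<epsilon> * h"
    using h by (intro mult_right_mono) auto
  moreover have "\<alpha> * x powr (- \<alpha> - 1) * h * sigma_int (x / 2) \<le> \<alpha> * x powr (- \<alpha> - 1) * h * sigma_int (x - h)"
    using h assms order_pos by (intro mult_left_mono less_imp_le[OF sigma_int_less]) auto
  ultimately have "3 * (\<epsilon> * h) \<le> 2 * (\<epsilon> * h)" by (simp add: \<epsilon>_def algebra_simps)
  with mult_pos_pos[OF \<epsilon> h(5)] show False by linarith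
qed

text \<open>Passing from the profile to \<open>sigma_factor\<close> gives continuity and the value 1
  at 0. A failure would therefore produce a least positive zero, and with it a first zero of the
  profile.\<close>

lemma sigma_factor_pos:
  assumes "0 \<le> z"
  shows "0 < sigma_factor z"
proof (rule ccontr)
  assume "\<not> 0 < sigma_factor z"
  have zero_below: "\<exists>y. 0 \<le> y \<and> y \<le> w \<and> sigma_factor y = 0" if "0 \<le> w" "sigma_factor w \<le> 0" for w
    using IVT2'[of sigma_factor w 0 0] that continuous_on_sigma_factor by auto
  define Z where "Z = {0..} \<inter> sigma_factor -` {0}"
  have "closed Z"
    unfolding Z_def by (intro continuous_closed_preimage continuous_on_sigma_factor) auto
  moreover have "Z \<noteq> {}" using zero_below[of z] assms \<open>\<not> 0 < sigma_factor z\<close> by (auto simp: Z_def)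
  moreover have bdd: "bdd_below Z" by (rule bdd_belowI[of _ 0]) (auto simp: Z_def)
  ultimately have "Inf Z \<in> Z" by (intro closed_contains_Inf)
  define x where "x = Inf Z powr (1 / (1 + \<alpha>))"
  have "Inf Z \<noteq> 0" using \<open>Inf Z \<in> Z\<close> by (auto simp: Z_def)
  then have pos: "0 < Inf Z" using \<open>Inf Z \<in> Z\<close> by (auto simp: Z_def)
  then have x: "0 < x" "x powr (1 + \<alpha>) = Inf Z" using order_pos by (auto simp: x_def powr_powr)
  have "0 < ml_sigma \<alpha> w" if "0 < w" "w < x" for w
  proof -
    have "w powr (1 + \<alpha>) < Inf Z"
      unfolding x(2) [symmetric] using that order_pos by (intro powr_less_mono2) auto
    then have "0 < sigma_factor (w powr (1 + \<alpha>))"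
      using zero_below[of "w powr (1 + \<alpha>)"] cInf_lower[OF _ bdd] by (force simp: Z_def)
    then show ?thesis using that by (simp add: ml_sigma_eq)
  qed
  with ml_sigma_no_first_zero[OF x(1)] have "ml_sigma \<alpha> x \<noteq> 0" by blast
  then show False using \<open>Inf Z \<in> Z\<close> by (simp add: ml_sigma_eq x(2) Z_def)
qed

lemma ml_sigma_pos: "0 < w \<Longrightarrow> 0 < ml_sigma \<alpha> w"
  by (simp add: ml_sigma_eq sigma_factor_pos)

section \<open>The equation for the free boundary coefficient\<close>

text \<open>The derivative is nonpositive now that the profile is positive. The bound is used to
  find a point where the function \<open>F\<close> below is nonpositive.\<close>

lemma frac_int_le:
  assumes "0 \<le> x"
  shows "frac_int x \<le> Gamma \<alpha>"
proof -
  have "frac_int x \<le> frac_int 0"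
  proof (rule DERIV_nonpos_imp_decreasing_open[OF assms])
    fix w :: real assume w: "0 < w" "w < x"
    have "- w * ml_sigma \<alpha> w / (1 + \<alpha>) \<le> 0"
      using w order_pos ml_sigma_pos[of w] by simp
    then show "\<exists>y. (frac_int has_real_derivative y) (at w) \<and> y \<le> 0"
      using frac_int_has_derivative[OF w(1)] by blast
  qed (rule continuous_on_subset[OF continuous_on_frac_int], auto)
  then show ?thesis by simp
qed

text \<open>The moment formula cancels \<open>Gamma \<alpha>\<close>, so the fixed point equation
  becomes a balance between \<open>frac_int\<close> and \<open>sigma_int\<close>.\<close>

lemma H_fun_eq:
  assumes "0 < x"
  shows "H_fun \<alpha> U\<^sub>0 U\<^sub>m x = (U\<^sub>0 - U\<^sub>m) * (1 + \<alpha>) * frac_int x / sigma_int x"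
proof -
  have "Gamma \<alpha> * (1 + \<alpha>) - (1 + \<alpha>) * (Gamma \<alpha> - frac_int x) = (1 + \<alpha>) * frac_int x"
    by (simp add: algebra_simps)
  then show ?thesis
    unfolding H_fun_def ml_sigma_moment[OF assms] sigma_int_def by simp
qed

lemma H_fun_unique_fixpoint:
  assumes "U\<^sub>m < U\<^sub>0"
  shows "\<exists>!\<xi>. 0 < \<xi> \<and> H_fun \<alpha> U\<^sub>0 U\<^sub>m \<xi> = \<xi>"
proof -
  define k where "k = (U\<^sub>0 - U\<^sub>m) * (1 + \<alpha>)"
  define F where "F x = k * frac_int x - x * sigma_int x" for x
  have k: "0 < k" using assms order_pos by (simp add: k_def)
  have s_pos: "0 < sigma_int x" if "0 < x" for x
    using that by (intro sigma_int_pos ml_sigma_pos)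
  have s_mono: "sigma_int x < sigma_int y" if "0 < x" "x < y" for x y
    using that by (intro sigma_int_less ml_sigma_pos) auto
  have F_iff: "H_fun \<alpha> U\<^sub>0 U\<^sub>m x = x \<longleftrightarrow> F x = 0" if "0 < x" for x
    using s_pos[OF that] by (simp add: H_fun_eq[OF that] F_def k_def divide_eq_eq)
  have F_deriv: "(F has_real_derivative
      k * (- x * ml_sigma \<alpha> x / (1 + \<alpha>)) - (sigma_int x + x * ml_sigma \<alpha> x)) (at x)" if "0 < x" for x
    unfolding F_def [abs_def]
    by (auto intro!: derivative_eq_intros frac_int_has_derivative[OF that] sigma_int_has_derivative[OF that])
  have F_neg: "k * (- x * ml_sigma \<alpha> x / (1 + \<alpha>)) - (sigma_int x + x * ml_sigma \<alpha> x) < 0" if "0 < x" for x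
  proof -
    have "0 \<le> k * (x * ml_sigma \<alpha> x / (1 + \<alpha>))" "0 < x * ml_sigma \<alpha> x"
      using that k order_pos ml_sigma_pos[OF that] by simp_all
    then show ?thesis using s_pos[OF that] by simp
  qed
  have F_less: "F y < F x" if "0 < x" "x < y" for x y
  proof (rule DERIV_neg_imp_decreasing[OF that(2)])
    fix w assume "x \<le> w" "w \<le> y"
    then show "\<exists>d. (F has_real_derivative d) (at w) \<and> d < 0"
      using that F_deriv[of w] F_neg[of w] by auto
  qed
  \<comment> \<open>For \<open>x < 1\<close> this is a lower bound of \<open>F x\<close> whose limit
    at 0 involves only that of \<open>frac_int\<close>.\<close>
  have "((\<lambda>x. k * frac_int x - x * sigma_int 1) \<longlongrightarrow> k * Gamma \<alpha> - 0 * sigma_int 1) (at_right 0)"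
    by (intro tendsto_intros frac_int_tendsto_0)
  then have "\<forall>\<^sub>F x in at_right 0. 0 < k * frac_int x - x * sigma_int 1"
    by (rule order_tendstoD(1)) (use k order_pos in simp)
  moreover have "\<forall>\<^sub>F x in at_right (0 :: real). 0 < x" "\<forall>\<^sub>F x in at_right (0 :: real). x < 1"
    by (auto intro: eventually_at_right_less eventually_at_rightI[of 0 1])
  ultimately have "\<forall>\<^sub>F x in at_right 0. 0 < k * frac_int x - x * sigma_int 1 \<and> 0 < x \<and> x < 1"
    by eventually_elim auto
  from eventually_happens[OF this] obtain a where
    a: "0 < k * frac_int a - a * sigma_int 1" "0 < a" "a < 1" by auto
  have "a * sigma_int a < a * sigma_int 1" using a s_mono by simp
  then have Fa: "0 < F a" using a(1) by (simp add: F_def)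
  \<comment> \<open>Chosen so that \<open>(b - 1) * sigma_int 1\<close> equals the upper bound
    \<open>k * Gamma \<alpha>\<close> of \<open>k * frac_int b\<close>; the summand 1 ensures
    \<open>1 < b\<close>, so that \<open>sigma_int 1 < sigma_int b\<close>.\<close>
  define b where "b = k * Gamma \<alpha> / sigma_int 1 + 1"
  have b: "1 < b" using k order_pos s_pos[of 1] by (simp add: b_def)
  have "k * frac_int b \<le> k * Gamma \<alpha>" using k b frac_int_le[of b] by simp
  also have "\<dots> = (b - 1) * sigma_int 1" using s_pos[of 1] by (simp add: b_def)
  also have "\<dots> \<le> (b - 1) * sigma_int b" using b s_mono[of 1 b] by (intro mult_left_mono) auto
  also have "\<dots> \<le> b * sigma_int b" using b s_pos[of b] by simp
  finally have Fb: "F b \<le> 0" by (simp add: F_def)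
  have "continuous_on {a..b} F"
    using a(2) by (intro continuous_at_imp_continuous_on ballI DERIV_isCont[OF F_deriv]) auto
  with Fa Fb a b obtain \<xi> where \<xi>: "a \<le> \<xi>" "F \<xi> = 0"
    using IVT2'[of F b 0 a] by auto
  show ?thesis
  proof (rule ex1I[of _ \<xi>])
    show "0 < \<xi> \<and> H_fun \<alpha> U\<^sub>0 U\<^sub>m \<xi> = \<xi>" using \<xi> a F_iff by auto
    fix \<eta> assume "0 < \<eta> \<and> H_fun \<alpha> U\<^sub>0 U\<^sub>m \<eta> = \<eta>"
    then have "0 < \<eta>" "F \<eta> = 0" using F_iff by auto
    then show "\<eta> = \<xi>" using \<xi> a F_less[of \<eta> \<xi>] F_less[of \<xi> \<eta>] by (cases \<eta> \<xi> rule: linorder_cases) auto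
  qed
qed

section \<open>The self-similar solution\<close>

text \<open>Under \<open>p = c * w\<close> the kernel contributes
  \<open>c powr (- \<alpha>)\<close>, while the Jacobian cancels the factor \<open>1 / c\<close> of
  the derivative. The normalisation by \<open>Gamma (1 - \<alpha>)\<close> cancels as well.\<close>

lemma caputo_self_similar:
  assumes "0 < c" "0 < x"
    and f: "\<And>p. 0 < p \<Longrightarrow> (f has_real_derivative k * ml_sigma \<alpha> (p / c) / c) (at p)"
  shows "caputo_exists \<alpha> f x" and "caputo_deriv \<alpha> f x = k * c powr (- \<alpha>) * frac_int (x / c)"
proof -
  define g where "g w = indicator {0<..<x / c} w * (ml_sigma \<alpha> w / (x / c - w) powr \<alpha>)" for w
  have "has_bochner_integral lborel g (Gamma (1 - \<alpha>) * frac_int (x / c))"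
    unfolding g_def using assms by (intro has_bochner_integral_frac_int) auto
  then have "has_bochner_integral lborel (\<lambda>p. g (0 + (1 / c) * p)) ((Gamma (1 - \<alpha>) * frac_int (x / c)) /\<^sub>R \<bar>1 / c\<bar>)"
    using assms by (subst (asm) lborel_has_bochner_integral_real_affine_iff[of "1 / c" _ _ 0]) auto
  then have "has_bochner_integral lborel (\<lambda>p. k * c powr (- \<alpha>) / c * g (0 + (1 / c) * p))
      (k * c powr (- \<alpha>) / c * ((Gamma (1 - \<alpha>) * frac_int (x / c)) /\<^sub>R \<bar>1 / c\<bar>))"
    by (rule has_bochner_integral_mult_right)
  moreover have "k * c powr (- \<alpha>) / c * g (0 + (1 / c) * p)
      = indicator {0<..<x} p *\<^sub>R (deriv f p / (x - p) powr \<alpha>)" for p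
  proof (cases "p \<in> {0<..<x}")
    case True
    then have "deriv f p = k * ml_sigma \<alpha> (p / c) / c"
      using DERIV_imp_deriv[OF f] by simp
    moreover have "(x / c - p / c) powr \<alpha> = (x - p) powr \<alpha> / c powr \<alpha>"
      using assms True by (simp add: powr_divide flip: diff_divide_distrib)
    ultimately show ?thesis
      using assms True by (simp add: g_def powr_minus divide_strict_right_mono field_simps)
  next
    case False
    then have "p / c \<notin> {0<..<x / c}"
      using assms by (auto simp: zero_less_divide_iff divide_less_cancel)
    then show ?thesis using False by (simp add: g_def)
  qed
  ultimately have *: "has_bochner_integral lborel (\<lambda>p. indicator {0<..<x} p *\<^sub>R (deriv f p / (x - p) powr \<alpha>))
      (Gamma (1 - \<alpha>) * (k * c powr (- \<alpha>) * frac_int (x / c)))"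
    using assms by (simp add: mult_ac)
  show "caputo_exists \<alpha> f x"
    using * f unfolding caputo_exists_def interval_lborel_0(1)[OF assms(2)] set_integrable_def
    by (auto simp: has_bochner_integral_iff real_differentiable_def)
  have "Gamma (1 - \<alpha>) \<noteq> 0" using order_less_1 Gamma_real_pos[of "1 - \<alpha>"] by linarith
  then show "caputo_deriv \<alpha> f x = k * c powr (- \<alpha>) * frac_int (x / c)"
    unfolding caputo_deriv_def interval_lborel_0(2)[OF assms(2)] set_lebesgue_integral_def
      has_bochner_integral_integral_eq[OF *] by simp
qed

lemma u_sol_eq:
  "u_sol \<alpha> U\<^sub>0 U\<^sub>m \<xi> x t = U\<^sub>0 - (U\<^sub>0 - U\<^sub>m) / sigma_int \<xi> * sigma_int (x / t powr (1 / (1 + \<alpha>)))"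
  by (simp add: u_sol_def sigma_int_def)

lemma u_sol_space_derivative:
  fixes t x :: real
  defines "c \<equiv> t powr (1 / (1 + \<alpha>))"
  assumes "0 < t" "0 < x"
  shows "((\<lambda>x. u_sol \<alpha> U\<^sub>0 U\<^sub>m \<xi> x t) has_real_derivative
           - ((U\<^sub>0 - U\<^sub>m) / sigma_int \<xi>) * ml_sigma \<alpha> (x / c) / c) (at x)"
proof -
  have c: "0 < c" using assms by (simp add: c_def)
  have "((\<lambda>x. sigma_int (x / c)) has_real_derivative ml_sigma \<alpha> (x / c) * (1 / c)) (at x)"
    using c assms by (intro DERIV_chain2[OF sigma_int_has_derivative]) (auto intro!: derivative_eq_intros)
  then have "((\<lambda>x. U\<^sub>0 - (U\<^sub>0 - U\<^sub>m) / sigma_int \<xi> * sigma_int (x / c)) has_real_derivative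
      0 - (U\<^sub>0 - U\<^sub>m) / sigma_int \<xi> * (ml_sigma \<alpha> (x / c) * (1 / c))) (at x)"
    by (intro DERIV_diff DERIV_const DERIV_cmult)
  then show ?thesis
    unfolding u_sol_eq c_def [symmetric] by simp
qed

lemma u_sol_time_derivative:
  fixes t x :: real
  defines "c \<equiv> t powr (1 / (1 + \<alpha>))"
  assumes "0 < t" "0 < x"
  shows "((\<lambda>\<tau>. u_sol \<alpha> U\<^sub>0 U\<^sub>m \<xi> x \<tau>) has_real_derivative
           (U\<^sub>0 - U\<^sub>m) / sigma_int \<xi> * ml_sigma \<alpha> (x / c) * x / (1 + \<alpha>) * t powr (- 1 / (1 + \<alpha>) - 1)) (at t)"
proof -
  let ?q = "- 1 / (1 + \<alpha>)"
  have eq: "x / \<tau> powr (1 / (1 + \<alpha>)) = x * \<tau> powr ?q" for \<tau> :: real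
    using powr_minus_divide[of \<tau> "1 / (1 + \<alpha>)"] by simp
  have "((\<lambda>\<tau>. x * \<tau> powr ?q) has_real_derivative x * (?q * t powr (?q - 1))) (at t)"
    by (intro DERIV_cmult has_real_derivative_powr assms)
  moreover have "0 < x * t powr ?q" using assms by simp
  ultimately have "((\<lambda>\<tau>. sigma_int (x * \<tau> powr ?q)) has_real_derivative
      ml_sigma \<alpha> (x * t powr ?q) * (x * (?q * t powr (?q - 1)))) (at t)"
    by (intro DERIV_chain2[OF sigma_int_has_derivative])
  then have "((\<lambda>\<tau>. U\<^sub>0 - (U\<^sub>0 - U\<^sub>m) / sigma_int \<xi> * sigma_int (x * \<tau> powr ?q)) has_real_derivative
      0 - (U\<^sub>0 - U\<^sub>m) / sigma_int \<xi> * (ml_sigma \<alpha> (x * t powr ?q) * (x * (?q * t powr (?q - 1))))) (at t)"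
    by (intro DERIV_diff DERIV_const DERIV_cmult)
  then show ?thesis
    unfolding u_sol_eq eq c_def by (simp add: mult_ac)
qed

lemma u_sol_caputo:
  fixes t x :: real
  defines "c \<equiv> t powr (1 / (1 + \<alpha>))"
  assumes "0 < t" "0 < x"
  shows "caputo_exists \<alpha> (\<lambda>p. u_sol \<alpha> U\<^sub>0 U\<^sub>m \<xi> p t) x"
    and "caputo_deriv \<alpha> (\<lambda>p. u_sol \<alpha> U\<^sub>0 U\<^sub>m \<xi> p t) x =
           - ((U\<^sub>0 - U\<^sub>m) / sigma_int \<xi>) * c powr (- \<alpha>) * frac_int (x / c)"
  using assms caputo_self_similar[of c x, OF _ _ u_sol_space_derivative[of t, folded c_def]] by auto

lemma stefan_solution_similarity:
  assumes "0 < \<xi>" "H_fun \<alpha> U\<^sub>0 U\<^sub>m \<xi> = \<xi>"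
  shows "stefan_solution \<alpha> T U\<^sub>0 U\<^sub>m (u_sol \<alpha> U\<^sub>0 U\<^sub>m \<xi>) (s_sol \<alpha> \<xi>)"
proof -
  define K where "K = (U\<^sub>0 - U\<^sub>m) / sigma_int \<xi>"
  have s_pos: "0 < sigma_int \<xi>"
    using assms(1) by (intro sigma_int_pos ml_sigma_pos)
  \<comment> \<open>Established for every positive \<open>x\<close>, also at and beyond the free
    boundary, which gives the left limit in the Stefan condition.\<close>
  have heat: "(\<lambda>\<tau>. u_sol \<alpha> U\<^sub>0 U\<^sub>m \<xi> x \<tau>) differentiable (at t)" (is ?A)
      "(\<lambda>y. caputo_deriv \<alpha> (\<lambda>p. u_sol \<alpha> U\<^sub>0 U\<^sub>m \<xi> p t) y) differentiable (at x)" (is ?B)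
      "deriv (\<lambda>\<tau>. u_sol \<alpha> U\<^sub>0 U\<^sub>m \<xi> x \<tau>) t -
        deriv (\<lambda>y. caputo_deriv \<alpha> (\<lambda>p. u_sol \<alpha> U\<^sub>0 U\<^sub>m \<xi> p t) y) x = 0" (is ?C)
    if t: "0 < t" and x: "0 < x" for x t
  proof -
    define c where "c = t powr (1 / (1 + \<alpha>))"
    have c: "0 < c" using t by (simp add: c_def)
    have time: "((\<lambda>\<tau>. u_sol \<alpha> U\<^sub>0 U\<^sub>m \<xi> x \<tau>) has_real_derivative
        K * ml_sigma \<alpha> (x / c) * x / (1 + \<alpha>) * t powr (- 1 / (1 + \<alpha>) - 1)) (at t)"
      unfolding K_def c_def using t x by (rule u_sol_time_derivative)
    have "((\<lambda>y. frac_int (y / c)) has_real_derivative - (x / c) * ml_sigma \<alpha> (x / c) / (1 + \<alpha>) * (1 / c)) (at x)"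
      using c x by (intro DERIV_chain2[OF frac_int_has_derivative]) (auto intro!: derivative_eq_intros)
    then have "((\<lambda>y. - K * c powr (- \<alpha>) * frac_int (y / c)) has_real_derivative
        - K * c powr (- \<alpha>) * (- (x / c) * ml_sigma \<alpha> (x / c) / (1 + \<alpha>) * (1 / c))) (at x)"
      by (rule DERIV_cmult)
    then have space: "((\<lambda>y. caputo_deriv \<alpha> (\<lambda>p. u_sol \<alpha> U\<^sub>0 U\<^sub>m \<xi> p t) y) has_real_derivative
        - K * c powr (- \<alpha>) * (- (x / c) * ml_sigma \<alpha> (x / c) / (1 + \<alpha>) * (1 / c))) (at x)"
      by (rule has_field_derivative_transform_within_open[of _ _ _ "{0<..}"])
        (use t x in \<open>auto simp: u_sol_caputo(2) K_def c_def\<close>)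
    \<comment> \<open>With \<open>c = t powr (1 / (1 + \<alpha>))\<close> the time scaling of both
      sides of the diffusion equation agrees.\<close>
    have "c powr (- \<alpha>) / c / c = c powr (- \<alpha> - 1 - 1)"
      using c by (simp only: powr_diff powr_one)
    also have "\<dots> = t powr (- 1 / (1 + \<alpha>) - 1)"
      unfolding c_def powr_powr using order_pos by (intro arg_cong[of _ _ "(powr) t"]) (simp add: field_simps)
    finally have pw: "t powr (- 1 / (1 + \<alpha>) - 1) = c powr (- \<alpha>) / c / c" ..
    have "K * ml_sigma \<alpha> (x / c) * x / (1 + \<alpha>) * t powr (- 1 / (1 + \<alpha>) - 1)
        = - K * c powr (- \<alpha>) * (- (x / c) * ml_sigma \<alpha> (x / c) / (1 + \<alpha>) * (1 / c))"
      unfolding pw by (simp add: mult_ac)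
    with DERIV_imp_deriv[OF time] DERIV_imp_deriv[OF space] show ?C by simp
    show ?A ?B using time space by (auto simp: real_differentiable_def)
  qed
  have stefan: "\<exists>L. ((\<lambda>x. caputo_deriv \<alpha> (\<lambda>p. u_sol \<alpha> U\<^sub>0 U\<^sub>m \<xi> p t) x) \<longlongrightarrow> L) (at_left (s_sol \<alpha> \<xi> t)) \<and>
             (s_sol \<alpha> \<xi> has_real_derivative - L) (at t)" if t: "0 < t" for t
  proof -
    define c where "c = t powr (1 / (1 + \<alpha>))"
    have c: "0 < c" using t by (simp add: c_def)
    define s where "s = s_sol \<alpha> \<xi> t"
    have s: "0 < s" "s / c = \<xi>" using assms c by (auto simp: s_def s_sol_def c_def)
    \<comment> \<open>The left limit at the free boundary is simply the value there.\<close>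
    have "isCont (\<lambda>x. caputo_deriv \<alpha> (\<lambda>p. u_sol \<alpha> U\<^sub>0 U\<^sub>m \<xi> p t) x) s"
      using heat(2)[OF t s(1)] by (auto intro: DERIV_isCont simp: real_differentiable_def)
    then have lim: "((\<lambda>x. caputo_deriv \<alpha> (\<lambda>p. u_sol \<alpha> U\<^sub>0 U\<^sub>m \<xi> p t) x) \<longlongrightarrow>
        - K * c powr (- \<alpha>) * frac_int \<xi>) (at_left s)"
      using u_sol_caputo(2)[OF t s(1), of U\<^sub>0 U\<^sub>m \<xi>] s(2)
      by (auto simp: isCont_def K_def c_def intro: tendsto_within_subset)
    have "((\<lambda>t. \<xi> * t powr (1 / (1 + \<alpha>))) has_real_derivative
        \<xi> * (1 / (1 + \<alpha>) * t powr (1 / (1 + \<alpha>) - 1))) (at t)"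
      by (intro DERIV_cmult has_real_derivative_powr t)
    moreover have "\<xi> * (1 / (1 + \<alpha>) * t powr (1 / (1 + \<alpha>) - 1)) = - (- K * c powr (- \<alpha>) * frac_int \<xi>)"
    proof -
      have pw: "c powr (- \<alpha>) = t powr (1 / (1 + \<alpha>) - 1)"
        unfolding c_def powr_powr using order_pos by (intro arg_cong[of _ _ "(powr) t"]) (simp add: field_simps)
      \<comment> \<open>The fixed point equation is exactly the Stefan condition with the common
        power of \<open>t\<close> removed.\<close>
      have "\<xi> * (1 / (1 + \<alpha>)) = K * frac_int \<xi>"
        using assms(2) order_pos unfolding H_fun_eq[OF assms(1)] K_def by (simp add: field_simps)
      then have "\<xi> * (1 / (1 + \<alpha>)) * c powr (- \<alpha>) = K * frac_int \<xi> * c powr (- \<alpha>)" by (simp only:)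
      then show ?thesis unfolding pw by (simp add: mult_ac)
    qed
    ultimately have "(s_sol \<alpha> \<xi> has_real_derivative - (- K * c powr (- \<alpha>) * frac_int \<xi>)) (at t)"
      unfolding s_sol_def [abs_def] by (simp only:)
    with lim show ?thesis unfolding s_def by blast
  qed
  have fixed: "u_sol \<alpha> U\<^sub>0 U\<^sub>m \<xi> 0 t = U\<^sub>0" for t
    by (simp add: u_sol_def zero_ereal_def)
  have free: "u_sol \<alpha> U\<^sub>0 U\<^sub>m \<xi> (s_sol \<alpha> \<xi> t) t = U\<^sub>m" if "0 < t" for t
    using that s_pos by (simp add: u_sol_eq s_sol_def)
  have s_sol: "0 < s_sol \<alpha> \<xi> t" if "0 < t" for t
    using that assms(1) by (simp add: s_sol_def)
  have s_sol_0: "s_sol \<alpha> \<xi> 0 = 0" by (simp add: s_sol_def)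
  show ?thesis
    unfolding stefan_solution_def
    by (intro conjI allI impI; (elim conjE)?;
        (rule heat stefan u_sol_caputo(1) fixed free s_sol s_sol_0; assumption?))
qed

end

theorem theorem2:
  fixes \<alpha> T U\<^sub>0 U\<^sub>m :: real
  assumes "0 < \<alpha>" and "\<alpha> < 1" and "0 < T" and "U\<^sub>m < U\<^sub>0"
  shows "(\<exists>!\<xi>. 0 < \<xi> \<and> H_fun \<alpha> U\<^sub>0 U\<^sub>m \<xi> = \<xi>) \<and>
         (\<forall>\<xi>. 0 < \<xi> \<and> H_fun \<alpha> U\<^sub>0 U\<^sub>m \<xi> = \<xi> \<longrightarrow>
              stefan_solution \<alpha> T U\<^sub>0 U\<^sub>m (u_sol \<alpha> U\<^sub>0 U\<^sub>m \<xi>) (s_sol \<alpha> \<xi>))"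
proof -
  interpret stefan_order \<alpha> by unfold_locales (use assms in auto)
  show ?thesis
    using H_fun_unique_fixpoint[OF assms(4)] stefan_solution_similarity by blast
qed

end
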